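(* Let $(\Gamma,+,\cdot,\delta)$ be an $\mathbb{R}_{\ge0}$-semi-module (a metric Abelian monoid with $\mathbb{R}_{\ge0}$-action and homogeneous pseudo-metric $\delta$) which is complete as a pseudo-metric space. Then there exist a real Banach space $(\mathbf{B},\|\cdot\|)$ and a distance-preserving homomorphism $f:\Gamma\to\mathbf{B}$ (that is, $f(x+y)=f(x)+f(y)$, $f(\lambda\cdot x)=\lambda f(x)$ and $\|f(x)-f(y)\|=\delta(x,y)$ for all $x,y\in\Gamma$, $\lambda\in\mathbb{R}_{\ge 0}$) such that the image of $f$ is a closed convex cone in $\mathbf{B}$.
   Context: A pseudo-distance (pseudo-metric) satisfies all axioms of a distance except that it may vanish on pairs of distinct points; complete means every Cauchy sequence converges. For points $x,y$ write $x\stackrel{\delta}{=}y$ if $\delta(x,y)=0$. A metric Abelian monoid $(\Gamma,+,\delta)$ is a monoid (associative operation $+$ with neutral element $0$) with a pseudo-distance $\delta$ such that $\gamma+\gamma'\stackrel{\delta}{=}\gamma'+\gamma$ for all $\gamma,\gamma'\in\Gamma$, and $\delta(\gamma+\gamma',\gamma+\gamma'')\le \delta(\gamma',\gamma'')$ for all $\gamma,\gamma',\gamma''\in\Gamma$. It is homogeneous if $\delta(n\cdot\gamma_1,n\cdot\gamma_2)=n\,\delta(\gamma_1,\gamma_2)$ for all $n\in\mathbb{N}$, where $n\cdot\gamma$ is the $n$-fold sum. A homogeneous metric Abelian monoid is an $\mathbb{R}_{\ge0}$-semi-module if in addition there is an action of $\mathbb{R}_{\ge0}$, $(\lambda,\gamma)\mapsto\lambda\cdot\gamma$,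 such that for all $\lambda,\lambda'\in\mathbb{R}_{\ge0}$, $\gamma,\gamma'\in\Gamma$: $\lambda\cdot(\lambda'\cdot\gamma)\stackrel{\delta}{=}(\lambda\lambda')\cdot\gamma$, $\lambda\cdot(\gamma+\gamma')\stackrel{\delta}{=}\lambda\cdot\gamma+\lambda\cdot\gamma'$, $(\lambda+\lambda')\cdot\gamma\stackrel{\delta}{=}\lambda\cdot\gamma+\lambda'\cdot\gamma$, and $\delta(\lambda\cdot\gamma,\lambda\cdot\gamma')=\lambda\,\delta(\gamma,\gamma')$. *)

theory Defs
  imports "HOL-Analysis.Analysis" "HOL-Algebra.Module"
begin

locale pseudo_metric =
  fixes \<delta> :: "'a \<Rightarrow> 'a \<Rightarrow> real"
  assumes nonneg: "0 \<le> \<delta> x y"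
    and refl: "\<delta> x x = 0"
    and sym: "\<delta> x y = \<delta> y x"
    and triangle: "\<delta> x z \<le> \<delta> x y + \<delta> y z"

definition pm_Cauchy :: "('a \<Rightarrow> 'a \<Rightarrow> real) \<Rightarrow> (nat \<Rightarrow> 'a) \<Rightarrow> bool"
  where "pm_Cauchy \<delta> \<sigma> \<longleftrightarrow> (\<forall>\<epsilon>>0. \<exists>N. \<forall>m\<ge>N. \<forall>n\<ge>N. \<delta> (\<sigma> m) (\<sigma> n) < \<epsilon>)"

definition pm_complete :: "('a \<Rightarrow> 'a \<Rightarrow> real) \<Rightarrow> bool"
  where "pm_complete \<delta> \<longleftrightarrow>
    (\<forall>\<sigma>. pm_Cauchy \<delta> \<sigma> \<longrightarrow> (\<exists>x. (\<lambda>n. \<delta> (\<sigma> n) x) \<longlonglongrightarrow> 0))"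

text \<open>The monoid laws hold exactly (class \<^class>\<open>monoid_add\<close>, which is not
  commutative); commutativity holds only up to pseudo-distance 0.\<close>

locale metric_abelian_monoid = pseudo_metric \<delta>
  for \<delta> :: "'a::monoid_add \<Rightarrow> 'a \<Rightarrow> real" +
  assumes add_commute: "\<delta> (x + y) (y + x) = 0"
    and add_contraction: "\<delta> (x + y) (x + z) \<le> \<delta> y z"

definition nfold_sum :: "nat \<Rightarrow> 'a::monoid_add \<Rightarrow> 'a"
  where "nfold_sum n x = sum_list (replicate n x)"

locale homogeneous_metric_abelian_monoid = metric_abelian_monoid \<delta>
  for \<delta> :: "'a::monoid_add \<Rightarrow> 'a \<Rightarrow> real" +
  assumes homogeneous: "\<delta> (nfold_sum n x) (nfold_sum n y) = real n * \<delta> x y"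

text \<open>The action is only constrained at nonnegative scalars; its values at negative
  reals are junk.\<close>

locale nonneg_real_semimodule = homogeneous_metric_abelian_monoid \<delta>
  for \<delta> :: "'a::monoid_add \<Rightarrow> 'a \<Rightarrow> real" +
  fixes act :: "real \<Rightarrow> 'a \<Rightarrow> 'a"
  assumes act_act: "\<lbrakk>0 \<le> a; 0 \<le> b\<rbrakk> \<Longrightarrow> \<delta> (act a (act b x)) (act (a * b) x) = 0"
    and act_add_right: "0 \<le> a \<Longrightarrow> \<delta> (act a (x + y)) (act a x + act a y) = 0"
    and act_add_left: "\<lbrakk>0 \<le> a; 0 \<le> b\<rbrakk> \<Longrightarrow> \<delta> (act (a + b) x) (act a x + act b x) = 0"
    and act_dist: "0 \<le> a \<Longrightarrow> \<delta> (act a x) (act a y) = a * \<delta> x y"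

text \<open>Banach spaces with an explicit carrier, so that one can quantify existentially over
  them. Vector spaces are modules, in the sense of HOL-Algebra, over the field of reals; the
  multiplicative fields \<open>mult\<close> and \<open>one\<close> of the module record are unused.\<close>

definition real_ring :: "real ring"
  where "real_ring = \<lparr>carrier = UNIV, mult = (*), one = 1, zero = 0, add = (+)\<rparr>"

text \<open>The distance of a norm is 0 off the carrier because the locale
  \<^locale>\<open>Metric_space\<close> requires nonnegativity and symmetry on the whole type.\<close>

definition norm_dist :: "(real, 'b) module \<Rightarrow> ('b \<Rightarrow> real) \<Rightarrow> 'b \<Rightarrow> 'b \<Rightarrow> real"
  where "norm_dist B N x y =
    (if x \<in> carrier B \<and> y \<in> carrier B then N (x \<ominus>\<^bsub>B\<^esub> y) else 0)"

locale real_normed_module = Module.module real_ring B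
  for B :: "(real, 'b) module" +
  fixes N :: "'b \<Rightarrow> real"
  assumes norm_nonneg: "x \<in> carrier B \<Longrightarrow> 0 \<le> N x"
    and norm_eq_zero: "x \<in> carrier B \<Longrightarrow> N x = 0 \<longleftrightarrow> x = \<zero>\<^bsub>B\<^esub>"
    and norm_triangle: "\<lbrakk>x \<in> carrier B; y \<in> carrier B\<rbrakk> \<Longrightarrow> N (x \<oplus>\<^bsub>B\<^esub> y) \<le> N x + N y"
    and norm_smult: "x \<in> carrier B \<Longrightarrow> N (a \<odot>\<^bsub>B\<^esub> x) = \<bar>a\<bar> * N x"

locale real_banach_module = real_normed_module B N
  for B :: "(real, 'b) module" and N :: "'b \<Rightarrow> real" +
  assumes complete: "Metric_space.mcomplete (carrier B) (norm_dist B N)"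

definition norm_topology :: "(real, 'b) module \<Rightarrow> ('b \<Rightarrow> real) \<Rightarrow> 'b topology"
  where "norm_topology B N = Metric_space.mtopology (carrier B) (norm_dist B N)"

text \<open>Counterpart of \<^const>\<open>convex_cone\<close> for modules with explicit carrier.\<close>

definition convex_cone_in :: "(real, 'b) module \<Rightarrow> 'b set \<Rightarrow> bool"
  where "convex_cone_in B S \<longleftrightarrow> S \<noteq> {} \<and> S \<subseteq> carrier B \<and>
    (\<forall>x\<in>S. \<forall>y\<in>S. \<forall>u\<ge>0. \<forall>v\<ge>0. u + v = 1 \<longrightarrow> u \<odot>\<^bsub>B\<^esub> x \<oplus>\<^bsub>B\<^esub> v \<odot>\<^bsub>B\<^esub> y \<in> S) \<and>
    (\<forall>x\<in>S. \<forall>c\<ge>0. c \<odot>\<^bsub>B\<^esub> x \<in> S)"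

text \<open>HOL cannot quantify existentially over types, so the type from which the elements of
  the Banach space are drawn must be named. The following one imposes no restriction: every
  element of the closed linear span of the image of \<open>f\<close> is the limit of a sequence
  \<open>f (x n) - f (y n)\<close>, and is determined by the set of all sequences \<open>(x n, y n)\<close> of formal
  differences that represent it in this way.\<close>

type_synonym 'a difference_limit = "(nat \<Rightarrow> 'a \<times> 'a) set"

end

theory Submission
  imports Defs
begin

text \<open>Homogeneity forces \<open>\<delta>\<close> to be translation invariant. Hence the formal differences \<open>(a, b)\<close> with
  distance \<open>\<delta> (a + d) (c + b)\<close> between \<open>(a, b)\<close> and \<open>(c, d)\<close> satisfy the axioms of a normed real
  vector space up to pseudo-distance 0. So do their Cauchy sequences, which are moreover complete,
  and identifying points at distance 0 yields the Banach space. The image of \<open>\<Gamma>\<close> is closed because it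
  is isometric to a complete space.\<close>

section \<open>Vector spaces up to pseudo-distance zero\<close>

lemma cring_real_ring: "cring real_ring"
  by (rule cringI; (rule abelian_groupI comm_monoidI)?)
    (auto simp: real_ring_def algebra_simps intro: exI[of _ "- _"] ab_left_minus)

text \<open>The axioms of a normed space, with each equation weakened to distance 0. They are needed
  twice, for formal differences and then for Cauchy sequences of them; the latter form a proper
  subset of their type, hence the carrier \<open>S\<close>. Negation is scaling by -1.\<close>

locale pseudo_normed_space =
  fixes S :: "'b set" and D :: "'b \<Rightarrow> 'b \<Rightarrow> real"
    and zero :: 'b and add :: "'b \<Rightarrow> 'b \<Rightarrow> 'b" and scale :: "real \<Rightarrow> 'b \<Rightarrow> 'b"
  assumes zero_mem: "zero \<in> S"
    and add_mem: "\<lbrakk>x \<in> S; y \<in> S\<rbrakk> \<Longrightarrow> add x y \<in> S"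
    and scale_mem: "x \<in> S \<Longrightarrow> scale a x \<in> S"
    and D_refl: "x \<in> S \<Longrightarrow> D x x = 0"
    and D_sym: "\<lbrakk>x \<in> S; y \<in> S\<rbrakk> \<Longrightarrow> D x y = D y x"
    and D_triangle: "\<lbrakk>x \<in> S; y \<in> S; z \<in> S\<rbrakk> \<Longrightarrow> D x z \<le> D x y + D y z"
    and D_add_right: "\<lbrakk>x \<in> S; y \<in> S; z \<in> S\<rbrakk> \<Longrightarrow> D (add x z) (add y z) \<le> D x y"
    and D_scale: "\<lbrakk>x \<in> S; y \<in> S\<rbrakk> \<Longrightarrow> D (scale a x) (scale a y) = \<bar>a\<bar> * D x y"
    and D_commute: "\<lbrakk>x \<in> S; y \<in> S\<rbrakk> \<Longrightarrow> D (add x y) (add y x) = 0"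
    and D_assoc: "\<lbrakk>x \<in> S; y \<in> S; z \<in> S\<rbrakk> \<Longrightarrow> D (add (add x y) z) (add x (add y z)) = 0"
    and D_zero: "x \<in> S \<Longrightarrow> D (add zero x) x = 0"
    and D_minus: "x \<in> S \<Longrightarrow> D (add (scale (-1) x) x) zero = 0"
    and D_scale_add: "\<lbrakk>x \<in> S; y \<in> S\<rbrakk> \<Longrightarrow> D (scale a (add x y)) (add (scale a x) (scale a y)) = 0"
    and D_add_scale: "x \<in> S \<Longrightarrow> D (scale (a + b) x) (add (scale a x) (scale b x)) = 0"
    and D_scale_scale: "x \<in> S \<Longrightarrow> D (scale (a * b) x) (scale a (scale b x)) = 0"
    and D_scale_one: "x \<in> S \<Longrightarrow> D (scale 1 x) x = 0"
begin

lemma D_nonneg: "\<lbrakk>x \<in> S; y \<in> S\<rbrakk> \<Longrightarrow> 0 \<le> D x y"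
  using D_triangle[of x y x] D_refl[of x] D_sym[of x y] by simp

lemma D_zero_trans: "\<lbrakk>D x y = 0; D y z = 0; x \<in> S; y \<in> S; z \<in> S\<rbrakk> \<Longrightarrow> D x z = 0"
  using D_triangle[of x y z] D_nonneg[of x z] by simp

lemma D_cong_zero:
  assumes "D x x' = 0" "D y y' = 0" "x \<in> S" "x' \<in> S" "y \<in> S" "y' \<in> S"
  shows "D x y = D x' y'"
proof -
  have "D x y \<le> D x x' + D x' y' + D y' y"
    using D_triangle[of x x' y] D_triangle[of x' y' y] assms by simp
  moreover have "D x' y' \<le> D x' x + D x y + D y y'"
    using D_triangle[of x' x y'] D_triangle[of x y y'] assms by simp
  ultimately show ?thesis using assms D_sym by simp
qed

lemma D_add_left:
  assumes "x \<in> S" "y \<in> S" "z \<in> S"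
  shows "D (add z x) (add z y) \<le> D x y"
proof -
  have "D (add z x) (add z y) = D (add x z) (add y z)"
    using assms by (intro D_cong_zero D_commute add_mem) auto
  then show ?thesis using D_add_right[OF assms] by simp
qed

lemma D_add_add:
  assumes "x \<in> S" "x' \<in> S" "y \<in> S" "y' \<in> S"
  shows "D (add x y) (add x' y') \<le> D x x' + D y y'"
  using D_triangle[of "add x y" "add x' y" "add x' y'"] D_add_right[of x x' y] D_add_left[of y y' x']
  assms add_mem by simp

text \<open>Translations are only assumed to be non-expansive. Translating by -y gives one
  inequality, and translating back by y gives the other, because x - y + y is at distance 0 from
  x.\<close>

lemma D_diff_zero:
  assumes "x \<in> S" "y \<in> S"
  shows "D (add x (scale (-1) y)) zero = D x y"
proof (rule antisym)
  have m: "scale (-1) y \<in> S" using assms scale_mem by simp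
  have "D (add y (scale (-1) y)) zero = 0"
    using D_zero_trans[OF D_commute[of y "scale (-1) y"] D_minus[of y]] assms m add_mem zero_mem by simp
  then show "D (add x (scale (-1) y)) zero \<le> D x y"
    using D_triangle[of "add x (scale (-1) y)" "add y (scale (-1) y)" zero]
      D_add_right[of x y "scale (-1) y"] assms m add_mem zero_mem by simp
  have "D (add (add x (scale (-1) y)) y) (add x zero) = 0"
    using D_zero_trans[OF D_assoc[of x "scale (-1) y" y], of "add x zero"]
      D_add_left[of "add (scale (-1) y) y" zero x] D_minus[of y] D_nonneg[of "add x (add (scale (-1) y) y)" "add x zero"]
      assms m add_mem zero_mem by simp
  moreover have "D (add x zero) x = 0"
    using D_zero_trans[OF D_commute[of x zero] D_zero[of x]] assms add_mem zero_mem by simp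
  ultimately have "D (add (add x (scale (-1) y)) y) x = 0"
    using D_zero_trans assms m add_mem zero_mem by meson
  then have "D x y = D (add (add x (scale (-1) y)) y) (add zero y)"
    using D_zero[of y] assms m add_mem zero_mem D_sym by (intro D_cong_zero) auto
  also have "\<dots> \<le> D (add x (scale (-1) y)) zero"
    using assms m add_mem zero_mem by (intro D_add_right) auto
  finally show "D x y \<le> D (add x (scale (-1) y)) zero" .
qed

section \<open>The quotient\<close>

definition coset :: "'b \<Rightarrow> 'b set"
  where "coset x = {y \<in> S. D x y = 0}"

definition repr :: "'b set \<Rightarrow> 'b"
  where "repr X = (SOME x. x \<in> X)"

text \<open>The fields \<open>mult\<close> and \<open>one\<close> are junk.\<close>

definition quotient :: "(real, 'b set) module"
  where "quotient = \<lparr>carrier = coset ` S, mult = (\<lambda>X Y. X), one = coset zero, zero = coset zero,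
    add = (\<lambda>X Y. coset (add (repr X) (repr Y))), smult = (\<lambda>a X. coset (scale a (repr X)))\<rparr>"

definition quotient_norm :: "'b set \<Rightarrow> real"
  where "quotient_norm X = D (repr X) zero"

lemma coset_eq_iff:
  assumes "x \<in> S" "y \<in> S"
  shows "coset x = coset y \<longleftrightarrow> D x y = 0"
proof
  assume "coset x = coset y"
  moreover have "y \<in> coset y" using assms D_refl by (simp add: coset_def)
  ultimately show "D x y = 0" by (auto simp: coset_def)
next
  assume "D x y = 0"
  then have "D x z = D y z" if "z \<in> S" for z
    using assms D_cong_zero[of x y z z] D_refl that by simp
  then show "coset x = coset y" by (auto simp: coset_def)
qed

lemma repr_coset:
  assumes "x \<in> S"
  shows "repr (coset x) \<in> S" "D (repr (coset x)) x = 0"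
proof -
  have "x \<in> coset x" using assms D_refl by (simp add: coset_def)
  then have "repr (coset x) \<in> coset x" unfolding repr_def by (rule someI)
  then show "repr (coset x) \<in> S" "D (repr (coset x)) x = 0"
    using D_sym assms by (auto simp: coset_def)
qed

lemma carrier_quotient: "carrier quotient = coset ` S"
  by (simp add: quotient_def)

lemma zero_quotient: "\<zero>\<^bsub>quotient\<^esub> = coset zero"
  by (simp add: quotient_def)

text \<open>The choice made by \<open>repr\<close> is harmless: by \<open>D_add_add\<close>,
  representatives at distance 0 have sums at distance 0.\<close>

lemma add_quotient:
  assumes "x \<in> S" "y \<in> S"
  shows "coset x \<oplus>\<^bsub>quotient\<^esub> coset y = coset (add x y)"
proof -
  have "D (add (repr (coset x)) (repr (coset y))) (add x y) = 0"
    using D_add_add[of "repr (coset x)" x "repr (coset y)" y] repr_coset assms add_mem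
      D_nonneg[of "add (repr (coset x)) (repr (coset y))" "add x y"] by simp
  then show ?thesis
    using coset_eq_iff[of "add (repr (coset x)) (repr (coset y))" "add x y"] repr_coset assms add_mem
    by (simp add: quotient_def)
qed

lemma smult_quotient:
  assumes "x \<in> S"
  shows "a \<odot>\<^bsub>quotient\<^esub> coset x = coset (scale a x)"
  using coset_eq_iff[of "scale a (repr (coset x))" "scale a x"] repr_coset assms scale_mem
    D_scale[of "repr (coset x)" x a]
  by (simp add: quotient_def)

lemma quotient_norm_coset:
  assumes "x \<in> S"
  shows "quotient_norm (coset x) = D x zero"
  unfolding quotient_norm_def
  using repr_coset[OF assms] assms zero_mem D_refl by (intro D_cong_zero) auto

lemmas quotient_simps = carrier_quotient zero_quotient add_quotient smult_quotient

lemma abelian_group_quotient: "abelian_group quotient"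
proof (rule abelian_groupI)
  show "\<exists>Y\<in>carrier quotient. Y \<oplus>\<^bsub>quotient\<^esub> X = \<zero>\<^bsub>quotient\<^esub>" if "X \<in> carrier quotient" for X
  proof -
    from that obtain x where x: "x \<in> S" "X = coset x" by (auto simp: carrier_quotient)
    then show ?thesis
      using scale_mem[of x "-1"] D_minus[of x] zero_mem add_mem coset_eq_iff
      by (intro bexI[of _ "coset (scale (-1) x)"]) (auto simp: quotient_simps)
  qed
\<comment> \<open>Elements of the carrier are themselves sets, so \<open>subset_antisym\<close>
  would split equations between them into inclusions, out of reach of
  \<open>coset_eq_iff\<close>.\<close>
qed (use zero_mem add_mem D_commute D_assoc D_zero in
  \<open>auto simp: quotient_simps coset_eq_iff del: subset_antisym\<close>)

lemma module_quotient: "Module.module real_ring quotient"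
proof (rule moduleI[OF cring_real_ring abelian_group_quotient])
qed (use add_mem scale_mem D_scale_add D_add_scale D_scale_scale D_scale_one in
  \<open>auto simp: quotient_simps coset_eq_iff real_ring_def del: subset_antisym\<close>)

lemma minus_quotient:
  assumes "x \<in> S" "y \<in> S"
  shows "coset x \<ominus>\<^bsub>quotient\<^esub> coset y = coset (add x (scale (-1) y))"
proof -
  interpret abelian_group quotient by (rule abelian_group_quotient)
  have "\<ominus>\<^bsub>quotient\<^esub> coset y = coset (scale (-1) y)"
    using assms scale_mem zero_mem add_mem D_minus
    by (intro minus_equality) (auto simp: quotient_simps coset_eq_iff)
  then show ?thesis using assms scale_mem by (simp add: a_minus_def add_quotient)
qed

lemma norm_minus_quotient:
  assumes "x \<in> S" "y \<in> S"
  shows "quotient_norm (coset x \<ominus>\<^bsub>quotient\<^esub> coset y) = D x y"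
  using assms add_mem scale_mem by (simp add: minus_quotient quotient_norm_coset D_diff_zero)

lemma norm_dist_quotient:
  assumes "x \<in> S" "y \<in> S"
  shows "norm_dist quotient quotient_norm (coset x) (coset y) = D x y"
  using assms by (simp add: norm_dist_def norm_minus_quotient carrier_quotient)

lemma normed_quotient: "real_normed_module quotient quotient_norm"
proof (rule real_normed_module.intro[OF module_quotient], unfold_locales)
  fix X assume "X \<in> carrier quotient"
  then obtain x where x: "x \<in> S" "X = coset x" by (auto simp: carrier_quotient)
  show "0 \<le> quotient_norm X" "quotient_norm X = 0 \<longleftrightarrow> X = \<zero>\<^bsub>quotient\<^esub>"
    using x D_nonneg zero_mem by (auto simp: quotient_norm_coset zero_quotient coset_eq_iff)
  \<comment> \<open>This is not among the axioms; it is read off from the law a 0 = 0 in the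
    quotient module.\<close>
  have "D (scale a zero) zero = 0" for a
  proof -
    interpret Module.module real_ring quotient by (rule module_quotient)
    have "coset (scale a zero) = coset zero"
      using smult_r_null[of a] zero_mem by (simp add: zero_quotient smult_quotient real_ring_def)
    then show ?thesis using coset_eq_iff scale_mem zero_mem by simp
  qed
  then show "quotient_norm (a \<odot>\<^bsub>quotient\<^esub> X) = \<bar>a\<bar> * quotient_norm X" for a
    using x scale_mem D_cong_zero[of "scale a x" "scale a x" zero "scale a zero"] D_scale[of x zero a]
      D_refl zero_mem D_sym
    by (simp add: smult_quotient quotient_norm_coset)
  fix Y assume "Y \<in> carrier quotient"
  then obtain y where y: "y \<in> S" "Y = coset y" by (auto simp: carrier_quotient)
  have "D (add x y) zero \<le> D x zero + D y zero"
    using D_triangle[of "add x y" "add zero y" zero] D_add_right[of x zero y]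
      D_cong_zero[OF D_zero[of y], of zero zero] x y add_mem zero_mem D_refl by simp
  then show "quotient_norm (X \<oplus>\<^bsub>quotient\<^esub> Y) \<le> quotient_norm X + quotient_norm Y"
    using x y add_mem by (simp add: add_quotient quotient_norm_coset)
qed

lemma Metric_space_quotient: "Metric_space (carrier quotient) (norm_dist quotient quotient_norm)"
proof
  fix X Y
  show "0 \<le> norm_dist quotient quotient_norm X Y"
    using D_nonneg by (cases "X \<in> coset ` S \<and> Y \<in> coset ` S")
      (auto simp: norm_dist_quotient, auto simp: norm_dist_def carrier_quotient)
  show "norm_dist quotient quotient_norm X Y = norm_dist quotient quotient_norm Y X"
    using D_sym by (cases "X \<in> coset ` S \<and> Y \<in> coset ` S")
      (auto simp: norm_dist_quotient, auto simp: norm_dist_def carrier_quotient)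
qed (use D_triangle in
  \<open>auto simp: carrier_quotient norm_dist_quotient coset_eq_iff del: subset_antisym\<close>)

lemma limitin_quotient:
  assumes "\<And>n. \<sigma> n \<in> S" "x \<in> S"
  shows "limitin (norm_topology quotient quotient_norm) (\<lambda>n. coset (\<sigma> n)) (coset x) sequentially
    \<longleftrightarrow> (\<lambda>n. D (\<sigma> n) x) \<longlonglongrightarrow> 0"
proof -
  interpret Metric_space "carrier quotient" "norm_dist quotient quotient_norm"
    by (rule Metric_space_quotient)
  show ?thesis
    unfolding norm_topology_def limit_metric_sequentially LIMSEQ_def
    using assms D_nonneg by (auto simp: norm_dist_quotient carrier_quotient)
qed

lemma MCauchy_quotient:
  assumes "\<And>n. \<sigma> n \<in> S"
  shows "Metric_space.MCauchy (carrier quotient) (norm_dist quotient quotient_norm) (\<lambda>n. coset (\<sigma> n))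
    \<longleftrightarrow> pm_Cauchy D \<sigma>"
proof -
  interpret Metric_space "carrier quotient" "norm_dist quotient quotient_norm"
    by (rule Metric_space_quotient)
  show ?thesis
    unfolding MCauchy_def pm_Cauchy_def
    using assms by (auto simp: norm_dist_quotient carrier_quotient)
qed

text \<open>A Cauchy sequence of cosets lifts to a Cauchy sequence of representatives, as distances
  agree, and the coset of a limit of the latter is a limit of the former.\<close>

lemma banach_quotient:
  assumes complete: "\<And>\<sigma>. \<lbrakk>\<And>n. \<sigma> n \<in> S; pm_Cauchy D \<sigma>\<rbrakk> \<Longrightarrow> \<exists>x\<in>S. (\<lambda>n. D (\<sigma> n) x) \<longlonglongrightarrow> 0"
  shows "real_banach_module quotient quotient_norm"
proof (rule real_banach_module.intro[OF normed_quotient], unfold_locales)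
  interpret Metric_space "carrier quotient" "norm_dist quotient quotient_norm"
    by (rule Metric_space_quotient)
  show mcomplete
    unfolding mcomplete_def
  proof (intro allI impI)
    fix F assume F: "MCauchy F"
    define \<sigma> where "\<sigma> n = repr (F n)" for n
    have "F n \<in> carrier quotient" for n using F by (auto simp: MCauchy_def)
    then have "\<exists>x\<in>S. F n = coset x" for n by (auto simp: carrier_quotient)
    then have \<sigma>: "\<sigma> n \<in> S \<and> coset (\<sigma> n) = F n" for n
      using repr_coset coset_eq_iff unfolding \<sigma>_def by metis
    then have "pm_Cauchy D \<sigma>" using F MCauchy_quotient[of \<sigma>] by simp
    then obtain x where "x \<in> S" "(\<lambda>n. D (\<sigma> n) x) \<longlonglongrightarrow> 0" using complete \<sigma> by blast
    then show "\<exists>X. limitin mtopology F X sequentially"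
      using limitin_quotient[of \<sigma> x] \<sigma> by (auto simp: norm_topology_def)
  qed
qed

section \<open>The completion\<close>

definition Cauchy_seqs :: "(nat \<Rightarrow> 'b) set"
  where "Cauchy_seqs = {s. (\<forall>n. s n \<in> S) \<and> pm_Cauchy D s}"

text \<open>\<open>lim\<close> is meaningful only for convergent sequences;
  \<open>tendsto_lim_dist\<close> provides convergence on \<open>Cauchy_seqs\<close>.\<close>

definition lim_dist :: "(nat \<Rightarrow> 'b) \<Rightarrow> (nat \<Rightarrow> 'b) \<Rightarrow> real"
  where "lim_dist s t = lim (\<lambda>n. D (s n) (t n))"

lemma D_diff_le:
  assumes "x \<in> S" "y \<in> S" "x' \<in> S" "y' \<in> S"
  shows "\<bar>D x y - D x' y'\<bar> \<le> D x x' + D y y'"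
  using D_triangle[of x x' y] D_triangle[of x' y' y] D_triangle[of x' x y'] D_triangle[of x y y']
    D_sym[of x x'] D_sym[of y y'] assms by simp

text \<open>\<open>D\<close> is 1-Lipschitz in each argument by \<open>D_diff_le\<close>, so the
  distances form a Cauchy sequence of reals.\<close>

lemma tendsto_lim_dist:
  assumes "s \<in> Cauchy_seqs" "t \<in> Cauchy_seqs"
  shows "(\<lambda>n. D (s n) (t n)) \<longlonglongrightarrow> lim_dist s t"
proof -
  have mem: "s n \<in> S" "t n \<in> S" for n using assms by (auto simp: Cauchy_seqs_def)
  have "Cauchy (\<lambda>n. D (s n) (t n))"
  proof (rule CauchyI)
    fix e :: real assume "0 < e"
    then have "0 < e / 2" by simp
    then obtain M N where M: "\<forall>m\<ge>M. \<forall>n\<ge>M. D (s m) (s n) < e / 2"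
      and N: "\<forall>m\<ge>N. \<forall>n\<ge>N. D (t m) (t n) < e / 2"
      using assms unfolding Cauchy_seqs_def pm_Cauchy_def mem_Collect_eq by blast
    have "norm (D (s m) (t m) - D (s n) (t n)) < e" if "max M N \<le> m" "max M N \<le> n" for m n
    proof -
      have "D (s m) (s n) < e / 2" "D (t m) (t n) < e / 2" using M N that by auto
      then show ?thesis using D_diff_le[of "s m" "t m" "s n" "t n"] mem by simp
    qed
    then show "\<exists>M. \<forall>m\<ge>M. \<forall>n\<ge>M. norm (D (s m) (t m) - D (s n) (t n)) < e" by blast
  qed
  then show ?thesis
    unfolding lim_dist_def by (simp add: Cauchy_convergent_iff convergent_LIMSEQ_iff)
qed

lemma lim_dist_eqI: "(\<And>n. D (s n) (t n) = c) \<Longrightarrow> lim_dist s t = c"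
  unfolding lim_dist_def by (simp add: limI)

lemma Cauchy_seqs_mem: "s \<in> Cauchy_seqs \<Longrightarrow> \<forall>n. s n \<in> S"
  by (simp add: Cauchy_seqs_def)

lemma const_Cauchy_seqs: "x \<in> S \<Longrightarrow> (\<lambda>_. x) \<in> Cauchy_seqs"
  by (auto simp: Cauchy_seqs_def pm_Cauchy_def D_refl)

lemma Cauchy_seqs_add:
  assumes "s \<in> Cauchy_seqs" "t \<in> Cauchy_seqs"
  shows "(\<lambda>n. add (s n) (t n)) \<in> Cauchy_seqs"
proof -
  have mem: "s n \<in> S" "t n \<in> S" for n using assms by (auto simp: Cauchy_seqs_def)
  have "\<exists>N. \<forall>m\<ge>N. \<forall>n\<ge>N. D (add (s m) (t m)) (add (s n) (t n)) < e" if "0 < e" for e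
  proof -
    from that have "0 < e / 2" by simp
    then obtain M N where M: "\<forall>m\<ge>M. \<forall>n\<ge>M. D (s m) (s n) < e / 2"
      and N: "\<forall>m\<ge>N. \<forall>n\<ge>N. D (t m) (t n) < e / 2"
      using assms unfolding Cauchy_seqs_def pm_Cauchy_def mem_Collect_eq by blast
    have "D (add (s m) (t m)) (add (s n) (t n)) < e" if "max M N \<le> m" "max M N \<le> n" for m n
    proof -
      have "D (s m) (s n) < e / 2" "D (t m) (t n) < e / 2" using M N that by auto
      then show ?thesis using D_add_add[of "s m" "s n" "t m" "t n"] mem by simp
    qed
    then show ?thesis by blast
  qed
  then show ?thesis using mem add_mem by (simp add: Cauchy_seqs_def pm_Cauchy_def)
qed

lemma Cauchy_seqs_scale:
  assumes "s \<in> Cauchy_seqs"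
  shows "(\<lambda>n. scale a (s n)) \<in> Cauchy_seqs"
proof -
  have mem: "s n \<in> S" for n using assms by (auto simp: Cauchy_seqs_def)
  have "\<exists>N. \<forall>m\<ge>N. \<forall>n\<ge>N. D (scale a (s m)) (scale a (s n)) < e" if "0 < e" for e
  proof -
    \<comment> \<open>Dividing by |a| + 1 instead of |a| covers a = 0.\<close>
    from that have "0 < e / (\<bar>a\<bar> + 1)" by simp
    then obtain N where N: "\<forall>m\<ge>N. \<forall>n\<ge>N. D (s m) (s n) < e / (\<bar>a\<bar> + 1)"
      using assms by (auto simp: Cauchy_seqs_def pm_Cauchy_def)
    have "D (scale a (s m)) (scale a (s n)) < e" if "N \<le> m" "N \<le> n" for m n
    proof -
      have "(\<bar>a\<bar> + 1) * D (s m) (s n) < e" using N that by (simp add: field_simps)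
      then show ?thesis using D_nonneg[of "s m" "s n"] mem by (simp add: D_scale algebra_simps)
    qed
    then show ?thesis by blast
  qed
  then show ?thesis using mem scale_mem by (simp add: Cauchy_seqs_def pm_Cauchy_def)
qed

text \<open>The inequalities and the scaling law pass to the limit. The remaining laws hold termwise
  at distance 0, so the limit is that of a constant sequence.\<close>

lemma pseudo_normed_space_completion:
  "pseudo_normed_space Cauchy_seqs lim_dist (\<lambda>_. zero) (\<lambda>s t n. add (s n) (t n)) (\<lambda>a s n. scale a (s n))"
proof
  fix s t u assume st: "s \<in> Cauchy_seqs" "t \<in> Cauchy_seqs" and u: "u \<in> Cauchy_seqs"
  show "lim_dist s u \<le> lim_dist s t + lim_dist t u"
    using st u by (intro LIMSEQ_le[OF tendsto_lim_dist tendsto_add[OF tendsto_lim_dist tendsto_lim_dist]])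
      (auto intro!: D_triangle simp: Cauchy_seqs_def)
  show "lim_dist (\<lambda>n. add (s n) (u n)) (\<lambda>n. add (t n) (u n)) \<le> lim_dist s t"
    using st u by (intro LIMSEQ_le[OF tendsto_lim_dist tendsto_lim_dist] Cauchy_seqs_add)
      (auto intro!: D_add_right simp: Cauchy_seqs_def)
next
  fix s t assume st: "s \<in> Cauchy_seqs" "t \<in> Cauchy_seqs"
  show "lim_dist s t = lim_dist t s"
    using st D_sym by (auto simp: lim_dist_def Cauchy_seqs_def)
  fix a
  have "(\<lambda>n. \<bar>a\<bar> * D (s n) (t n)) \<longlonglongrightarrow> lim_dist (\<lambda>n. scale a (s n)) (\<lambda>n. scale a (t n))"
    using tendsto_lim_dist[OF Cauchy_seqs_scale Cauchy_seqs_scale, of s t a a] st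
    by (simp add: D_scale Cauchy_seqs_def)
  then show "lim_dist (\<lambda>n. scale a (s n)) (\<lambda>n. scale a (t n)) = \<bar>a\<bar> * lim_dist s t"
    using tendsto_mult_left[OF tendsto_lim_dist[OF st]] LIMSEQ_unique by blast
qed (auto intro!: lim_dist_eqI const_Cauchy_seqs zero_mem Cauchy_seqs_add Cauchy_seqs_scale D_refl
      D_commute D_assoc D_zero D_minus D_scale_add D_add_scale D_scale_scale D_scale_one
    dest: Cauchy_seqs_mem)

section \<open>Completeness of the space of Cauchy sequences\<close>

lemma lim_dist_le:
  assumes "s \<in> Cauchy_seqs" "t \<in> Cauchy_seqs" "\<And>n. n \<ge> N \<Longrightarrow> D (s n) (t n) \<le> c"
  shows "lim_dist s t \<le> c"
  using LIMSEQ_le_const2[OF tendsto_lim_dist[OF assms(1,2)]] assms(3) by blast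

text \<open>A diagonal argument: each \<open>\<sigma> k\<close> is close to the constant sequence at
  one of its late terms \<open>t k\<close>, and the sequence of these terms is the limit.\<close>

lemma complete_completion:
  assumes mem: "\<And>k. \<sigma> k \<in> Cauchy_seqs" and Cauchy: "pm_Cauchy lim_dist \<sigma>"
  shows "\<exists>t\<in>Cauchy_seqs. (\<lambda>k. lim_dist (\<sigma> k) t) \<longlonglongrightarrow> 0"
proof -
  have memS: "\<sigma> k n \<in> S" for k n using mem by (auto simp: Cauchy_seqs_def)
  have "\<exists>N. \<forall>m\<ge>N. \<forall>n\<ge>N. D (\<sigma> k m) (\<sigma> k n) < 1 / real (Suc k)" for k
    using mem[of k] by (simp add: Cauchy_seqs_def pm_Cauchy_def)
  \<comment> \<open>Beyond index \<open>M k\<close>, the terms of \<open>\<sigma> k\<close> differ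
    by less than 1/(k+1), so its term at \<open>M k\<close> approximates all of the tail.\<close>
  then obtain M where M: "D (\<sigma> k m) (\<sigma> k n) < 1 / real (Suc k)" if "m \<ge> M k" "n \<ge> M k" for k m n
    by metis
  define t where "t k = \<sigma> k (M k)" for k
  have tS: "t k \<in> S" for k using memS by (simp add: t_def)
  have near: "lim_dist (\<sigma> k) (\<lambda>_. t k) \<le> 1 / real (Suc k)" for k
    using M[of k _ "M k"] mem const_Cauchy_seqs[OF tS]
    by (intro lim_dist_le[of _ _ "M k"]) (auto simp: t_def less_imp_le)
  interpret C: pseudo_normed_space Cauchy_seqs lim_dist "\<lambda>_. zero"
    "\<lambda>s t n. add (s n) (t n)" "\<lambda>a s n. scale a (s n)"
    by (rule pseudo_normed_space_completion)
  have tD: "D (t k) (t l) \<le> 1 / real (Suc k) + lim_dist (\<sigma> k) (\<sigma> l) + 1 / real (Suc l)" for k l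
  proof -
    \<comment> \<open>Constant sequences embed \<open>S\<close> isometrically, which allows the
      triangle inequality to run through \<open>\<sigma> k\<close> and
      \<open>\<sigma> l\<close>.\<close>
    have "D (t k) (t l) = lim_dist (\<lambda>_. t k) (\<lambda>_. t l)"
      by (rule lim_dist_eqI[symmetric]) simp
    also have "\<dots> \<le> lim_dist (\<lambda>_. t k) (\<sigma> k) + lim_dist (\<sigma> k) (\<sigma> l) + lim_dist (\<sigma> l) (\<lambda>_. t l)"
      using C.D_triangle[of "\<lambda>_. t k" "\<sigma> k" "\<lambda>_. t l"] C.D_triangle[of "\<sigma> k" "\<sigma> l" "\<lambda>_. t l"]
        mem const_Cauchy_seqs[OF tS] by fastforce
    finally show ?thesis
      using near[of k] near[of l] C.D_sym[of "\<lambda>_. t k" "\<sigma> k"] mem const_Cauchy_seqs[OF tS] by simp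
  qed
  \<comment> \<open>One copy of 1/(k+1) comes from \<open>tD\<close>. The other is spare, and pays
    for the distance from \<open>\<sigma> k\<close> to the constant sequence at \<open>t k\<close>
    in the convergence proof. The three reciprocals stay below e/6 each.\<close>
  have bound: "\<exists>N. \<forall>k\<ge>N. \<forall>l\<ge>N. 2 / real (Suc k) + lim_dist (\<sigma> k) (\<sigma> l) + 1 / real (Suc l) < e" if e: "0 < e" for e
  proof -
    obtain K where K: "1 / real (Suc K) < e / 6" using e nat_approx_posE[of "e / 6"] by auto
    from e have "0 < e / 2" by simp
    then obtain N where N: "\<forall>k\<ge>N. \<forall>l\<ge>N. lim_dist (\<sigma> k) (\<sigma> l) < e / 2"
      using Cauchy unfolding pm_Cauchy_def by blast
    have inv: "1 / real (Suc k) < e / 6" if "k \<ge> K" for k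
      using K that frac_le[of 1 1 "real (Suc K)" "real (Suc k)"] by simp
    have "2 / real (Suc k) + lim_dist (\<sigma> k) (\<sigma> l) + 1 / real (Suc l) < e"
      if "k \<ge> max K N" "l \<ge> max K N" for k l
    proof -
      have "lim_dist (\<sigma> k) (\<sigma> l) < e / 2" using N that by simp
      moreover have "2 / real (Suc k) = 2 * (1 / real (Suc k))" by simp
      ultimately show ?thesis using inv[of k] inv[of l] that by linarith
    qed
    then show ?thesis by blast
  qed
  have "pm_Cauchy D t"
    unfolding pm_Cauchy_def
  proof (intro allI impI)
    fix e :: real assume "0 < e"
    then obtain N where N: "\<forall>k\<ge>N. \<forall>l\<ge>N. 2 / real (Suc k) + lim_dist (\<sigma> k) (\<sigma> l) + 1 / real (Suc l) < e"
      using bound by blast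
    have "D (t k) (t l) < e" if "k \<ge> N" "l \<ge> N" for k l
    proof -
      have "1 / real (Suc k) \<le> 2 / real (Suc k)" by (simp add: divide_right_mono)
      moreover have "2 / real (Suc k) + lim_dist (\<sigma> k) (\<sigma> l) + 1 / real (Suc l) < e" using N that by blast
      ultimately show ?thesis using tD[of k l] by linarith
    qed
    then show "\<exists>N. \<forall>m\<ge>N. \<forall>n\<ge>N. D (t m) (t n) < e" by blast
  qed
  then have t: "t \<in> Cauchy_seqs" using tS by (simp add: Cauchy_seqs_def)
  have "(\<lambda>k. lim_dist (\<sigma> k) t) \<longlonglongrightarrow> 0"
  proof (rule LIMSEQ_I)
    fix e :: real assume "0 < e"
    then have "0 < e / 2" by simp
    then obtain N where N: "\<forall>k\<ge>N. \<forall>l\<ge>N. 2 / real (Suc k) + lim_dist (\<sigma> k) (\<sigma> l) + 1 / real (Suc l) < e / 2"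
      using bound by blast
    have "norm (lim_dist (\<sigma> k) t - 0) < e" if k: "k \<ge> N" for k
    proof -
      \<comment> \<open>The subtracted 1/(k+1) is what \<open>near\<close> adds back. Limits
        preserve only weak inequalities, hence e/2 rather than e.\<close>
      have "lim_dist (\<lambda>_. t k) t \<le> e / 2 - 1 / real (Suc k)"
      proof (rule lim_dist_le[OF const_Cauchy_seqs[OF tS] t, of N])
        fix l assume "l \<ge> N"
        then have "2 / real (Suc k) + lim_dist (\<sigma> k) (\<sigma> l) + 1 / real (Suc l) < e / 2" using N k by blast
        moreover have "2 / real (Suc k) = 2 * (1 / real (Suc k))" by simp
        ultimately show "D (t k) (t l) \<le> e / 2 - 1 / real (Suc k)" using tD[of k l] by linarith
      qed
      then have "lim_dist (\<sigma> k) t \<le> e / 2"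
        using C.D_triangle[of "\<sigma> k" "\<lambda>_. t k" t] near[of k] mem t const_Cauchy_seqs[OF tS] by fastforce
      then show ?thesis using C.D_nonneg[of "\<sigma> k" t] mem t \<open>0 < e\<close> by simp
    qed
    then show "\<exists>N. \<forall>k\<ge>N. norm (lim_dist (\<sigma> k) t - 0) < e" by blast
  qed
  then show ?thesis using t by blast
qed

end

section \<open>Formal differences\<close>

context metric_abelian_monoid
begin

lemma add_contraction_left: "\<delta> (x + z) (y + z) \<le> \<delta> x y"
proof -
  have "\<delta> (x + z) (y + z) \<le> \<delta> (x + z) (z + x) + \<delta> (z + x) (z + y) + \<delta> (z + y) (y + z)"
    using triangle[of "x + z" "y + z" "z + x"] triangle[of "z + x" "y + z" "z + y"] by linarith
  then show ?thesis using add_commute[of x z] add_commute[of z y] add_contraction[of z x y] by linarith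
qed

lemma dist_add_le: "\<delta> (x + y) (x' + y') \<le> \<delta> x x' + \<delta> y y'"
  using triangle[of "x + y" "x' + y'" "x' + y"] add_contraction_left[of x y x'] add_contraction[of x' y y']
  by linarith

lemma dist_zero_cong: "\<lbrakk>\<delta> x x' = 0; \<delta> y y' = 0\<rbrakk> \<Longrightarrow> \<delta> x y = \<delta> x' y'"
  using triangle[of x y x'] triangle[of x' y y'] triangle[of x' y' x] triangle[of x y' y]
    sym[of x x'] sym[of y y'] by linarith

text \<open>Canonical representatives turn \<open>\<delta> x y = 0\<close> into an equation \<open>nf x = nf y\<close>, and the induced
  addition is associative and commutative on the nose, so that the simplifier can decide it.\<close>

definition nf :: "'a \<Rightarrow> 'a"
  where "nf x = (SOME y. \<delta> x y = 0)"

definition nf_add :: "'a \<Rightarrow> 'a \<Rightarrow> 'a"  (infixl \<open>\<boxplus>\<close> 65)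
  where "x \<boxplus> y = nf (x + y)"

lemma dist_nf: "\<delta> x (nf x) = 0"
  unfolding nf_def by (rule someI[of _ x]) (rule refl)

lemma nf_eq_iff: "nf x = nf y \<longleftrightarrow> \<delta> x y = 0"
proof
  assume "nf x = nf y"
  then show "\<delta> x y = 0"
    using dist_zero_cong[OF dist_nf[of x] dist_nf[of y]] refl[of "nf y"] by simp
next
  assume "\<delta> x y = 0"
  \<comment> \<open>The two choices in \<open>nf\<close> are then made from literally the same
    predicate.\<close>
  then have "\<delta> x = \<delta> y" using dist_zero_cong[of x y] refl by blast
  then show "nf x = nf y" by (simp add: nf_def)
qed

lemma nf_nf [simp]: "nf (nf x) = nf x"
  using dist_nf[of x] by (simp add: nf_eq_iff sym)

lemma dist_cong: "\<lbrakk>nf x = nf x'; nf y = nf y'\<rbrakk> \<Longrightarrow> \<delta> x y = \<delta> x' y'"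
  by (rule dist_zero_cong) (simp_all flip: nf_eq_iff)

lemma nf_plus: "nf (x + y) = nf x \<boxplus> nf y"
  using dist_add_le[of x y "nf x" "nf y"] dist_nf nonneg[of "x + y" "nf x + nf y"]
  by (simp add: nf_add_def nf_eq_iff)

text \<open>Only a semigroup: \<open>nf 0\<close> is neutral just on canonical representatives,
  since every sum is one.\<close>

sublocale nf_add: abel_semigroup nf_add
proof
  show "x \<boxplus> y = y \<boxplus> x" for x y by (simp add: nf_add_def nf_eq_iff add_commute)
  \<comment> \<open>Normalizing the arguments does not change the sum, so associativity holds for
    arbitrary elements.\<close>
  have "nf x \<boxplus> nf y = x \<boxplus> y" for x y by (metis nf_plus nf_add_def)
  then show "x \<boxplus> y \<boxplus> z = x \<boxplus> (y \<boxplus> z)" for x y z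
    by (metis nf_add_def nf_nf add.assoc)
qed

lemma nf_add_zero [simp]: "nf x \<boxplus> nf 0 = nf x" "nf 0 \<boxplus> nf x = nf x"
  using nf_plus[of x 0] nf_plus[of 0 x] by simp_all

end

section \<open>Translation invariance and cancellation\<close>

context homogeneous_metric_abelian_monoid
begin

text \<open>Translation invariance: moving from \<open>x + n \<cdot> y\<close> to \<open>x + n \<cdot> z\<close> by exchanging one summand at a
  time costs at most \<open>n\<close> times \<open>\<delta> (x + y) (x + z)\<close>, whereas the bounded error made by inserting \<open>x\<close>
  disappears on dividing by \<open>n\<close>.\<close>

lemma dist_add_nfold_le: "\<delta> (x + nfold_sum n y) (x + nfold_sum n z) \<le> real n * \<delta> (x + y) (x + z)"
proof (induction n)
  case 0
  then show ?case by (simp add: nfold_sum_def refl)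
next
  case (Suc n)
  let ?y = "nfold_sum n y" and ?z = "nfold_sum n z"
  have Suc_eq: "nfold_sum (Suc n) w = w + nfold_sum n w" for w by (simp add: nfold_sum_def)
  have "\<delta> (x + (y + ?y)) (x + (z + ?z)) \<le> \<delta> (x + (y + ?y)) (x + (z + ?y)) + \<delta> (x + (z + ?y)) (x + (z + ?z))"
    by (rule triangle)
  also have "\<delta> (x + (y + ?y)) (x + (z + ?y)) \<le> \<delta> (x + y) (x + z)"
    using add_contraction_left[of "x + y" ?y "x + z"] by (simp add: add.assoc)
  \<comment> \<open>The summand already exchanged is moved to the front, where contraction strips it
    off.\<close>
  also have "\<delta> (x + (z + ?y)) (x + (z + ?z)) = \<delta> (z + (x + ?y)) (z + (x + ?z))"
    by (rule dist_cong) (simp_all add: nf_plus nf_add.left_commute)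
  also have "\<dots> \<le> \<delta> (x + ?y) (x + ?z)" by (rule add_contraction)
  also have "\<dots> \<le> real n * \<delta> (x + y) (x + z)" by (rule Suc.IH)
  finally show ?case by (simp add: Suc_eq algebra_simps)
qed

lemma dist_add_left_cancel [simp]: "\<delta> (x + y) (x + z) = \<delta> y z"
proof (rule antisym[OF add_contraction])
  have "real n * (\<delta> y z - \<delta> (x + y) (x + z)) \<le> 2 * \<delta> 0 x" for n
  proof -
    \<comment> \<open>The cost of inserting x does not depend on w; it is paid once at each end,
      whence the factor 2.\<close>
    have *: "\<delta> w (x + w) \<le> \<delta> 0 x" for w using add_contraction_left[of 0 w x] by simp
    let ?y = "nfold_sum n y" and ?z = "nfold_sum n z"
    have "real n * \<delta> y z \<le> \<delta> ?y (x + ?y) + \<delta> (x + ?y) (x + ?z) + \<delta> ?z (x + ?z)"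
      using triangle[of ?y ?z "x + ?y"] triangle[of "x + ?y" ?z "x + ?z"] sym[of ?z "x + ?z"]
      by (simp add: homogeneous)
    then show ?thesis
      using *[of ?y] *[of ?z] dist_add_nfold_le[of x n y z] by (simp add: algebra_simps)
  qed
  then have "\<not> 0 < \<delta> y z - \<delta> (x + y) (x + z)"
    using reals_Archimedean3[of "\<delta> y z - \<delta> (x + y) (x + z)"] by (meson not_le)
  then show "\<delta> y z \<le> \<delta> (x + y) (x + z)" by simp
qed

lemma nf_add_left_cancel: "nf x \<boxplus> nf y = nf x \<boxplus> nf z \<longleftrightarrow> nf y = nf z"
  unfolding nf_plus[symmetric] nf_eq_iff by simp

end

section \<open>Laws of the action and of formal differences\<close>

context nonneg_real_semimodule
begin

lemma nf_act_add: "0 \<le> a \<Longrightarrow> nf (act a (x + y)) = nf (act a x) \<boxplus> nf (act a y)"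
  by (simp add: nf_eq_iff act_add_right flip: nf_plus)

lemma nf_add_act: "\<lbrakk>0 \<le> a; 0 \<le> b\<rbrakk> \<Longrightarrow> nf (act (a + b) x) = nf (act a x) \<boxplus> nf (act b x)"
  by (simp add: nf_eq_iff act_add_left flip: nf_plus)

lemma nf_act_act: "\<lbrakk>0 \<le> a; 0 \<le> b\<rbrakk> \<Longrightarrow> nf (act a (act b x)) = nf (act (a * b) x)"
  by (simp add: nf_eq_iff act_act)

text \<open>By 0 + 0 = 0 the element is idempotent under \<open>nf_add\<close>, and cancellation
  makes an idempotent neutral. The next lemma argues likewise.\<close>

lemma nf_zero_act [simp]: "nf (act 0 x) = nf 0"
  using nf_add_left_cancel[of "act 0 x" "act 0 x" 0] nf_add_act[of 0 0 x] by simp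

lemma nf_act_zero [simp]: "0 \<le> a \<Longrightarrow> nf (act a 0) = nf 0"
  using nf_add_left_cancel[of "act a 0" "act a 0" 0] nf_act_add[of a 0 0] by simp

text \<open>Acting by 1 preserves distances and sends both \<open>act 1 x\<close> and x to points at
  distance 0 from each other.\<close>

lemma nf_one_act [simp]: "nf (act 1 x) = nf x"
  using act_dist[of 1 "act 1 x" x] act_act[of 1 1 x] by (simp add: nf_eq_iff)

definition pair_dist :: "'a \<times> 'a \<Rightarrow> 'a \<times> 'a \<Rightarrow> real"
  where "pair_dist z w = \<delta> (fst z + snd w) (fst w + snd z)"

definition pair_add :: "'a \<times> 'a \<Rightarrow> 'a \<times> 'a \<Rightarrow> 'a \<times> 'a"
  where "pair_add z w = (fst z + fst w, snd z + snd w)"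

text \<open>The action of \<open>p - q\<close> on formal differences.\<close>

definition pair_act :: "real \<Rightarrow> real \<Rightarrow> 'a \<times> 'a \<Rightarrow> 'a \<times> 'a"
  where "pair_act p q z = (act p (fst z) + act q (snd z), act q (fst z) + act p (snd z))"

text \<open>Splitting into positive and negative part ensures that \<open>act\<close> only receives
  nonnegative scalars.\<close>

definition pair_scale :: "real \<Rightarrow> 'a \<times> 'a \<Rightarrow> 'a \<times> 'a"
  where "pair_scale a = pair_act (max a 0) (max (- a) 0)"

text \<open>Translation by d makes room for the intermediate point c + b + f; the two resulting
  distances are those of the pairs, translated by f and by b.\<close>

lemma pair_dist_triangle: "pair_dist u w \<le> pair_dist u v + pair_dist v w"
proof -
  obtain a b c d e f where [simp]: "u = (a, b)" "v = (c, d)" "w = (e, f)" by (metis surj_pair)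
  have "\<delta> (a + f) (e + b) = \<delta> (d + (a + f)) (d + (e + b))" by simp
  also have "\<dots> \<le> \<delta> (d + (a + f)) (c + b + f) + \<delta> (c + b + f) (d + (e + b))"
    by (rule triangle)
  also have "\<delta> (d + (a + f)) (c + b + f) = \<delta> (f + (a + d)) (f + (c + b))"
    by (rule dist_cong) (simp_all add: nf_plus nf_add.assoc nf_add.commute nf_add.left_commute)
  also have "\<delta> (c + b + f) (d + (e + b)) = \<delta> (b + (c + f)) (b + (e + d))"
    by (rule dist_cong) (simp_all add: nf_plus nf_add.assoc nf_add.commute nf_add.left_commute)
  finally show ?thesis by (simp add: pair_dist_def)
qed

lemma pair_dist_nonneg: "0 \<le> pair_dist z w"
  by (simp add: pair_dist_def nonneg)

lemma pair_dist_zero_trans: "\<lbrakk>pair_dist u v = 0; pair_dist v w = 0\<rbrakk> \<Longrightarrow> pair_dist u w = 0"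
  using pair_dist_triangle[of u w v] pair_dist_nonneg[of u w] by simp

lemma pair_dist_eq_zero_iff:
  "pair_dist z w = 0 \<longleftrightarrow> nf (fst z) \<boxplus> nf (snd w) = nf (fst w) \<boxplus> nf (snd z)"
  by (simp add: pair_dist_def nf_plus flip: nf_eq_iff)

lemmas nf_ac = nf_add.assoc nf_add.commute nf_add.left_commute

text \<open>Any nonnegative p, q with the right difference may replace the positive and negative
  parts, which spares case distinctions on signs. The reason is p + q' = p' + q, used in each
  component.\<close>

lemma pair_act_cong:
  assumes "0 \<le> p" "0 \<le> q" "0 \<le> p'" "0 \<le> q'" and eq: "p - q = p' - q'"
  shows "pair_dist (pair_act p q z) (pair_act p' q' z) = 0"
proof -
  have h: "nf (act p x) \<boxplus> nf (act q' x) = nf (act p' x) \<boxplus> nf (act q x)" for x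
    using assms nf_add_act[of p q' x] nf_add_act[of p' q x] by (simp add: algebra_simps)
  have "(nf (act p (fst z)) \<boxplus> nf (act q' (fst z))) \<boxplus> (nf (act p' (snd z)) \<boxplus> nf (act q (snd z)))
    = (nf (act p' (fst z)) \<boxplus> nf (act q (fst z))) \<boxplus> (nf (act p (snd z)) \<boxplus> nf (act q' (snd z)))"
    by (simp only: h)
  then show ?thesis
    by (simp add: pair_dist_eq_zero_iff pair_act_def nf_plus nf_ac)
qed

text \<open>Positive parts are not additive, but the sums of the positive and of the negative parts
  have the difference a + b.\<close>

lemma pair_scale_add_left: "pair_dist (pair_scale (a + b) z) (pair_add (pair_scale a z) (pair_scale b z)) = 0"
proof (rule pair_dist_zero_trans)
  show "pair_dist (pair_scale (a + b) z) (pair_act (max a 0 + max b 0) (max (- a) 0 + max (- b) 0) z) = 0"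
    unfolding pair_scale_def by (rule pair_act_cong) auto
  show "pair_dist (pair_act (max a 0 + max b 0) (max (- a) 0 + max (- b) 0) z)
    (pair_add (pair_scale a z) (pair_scale b z)) = 0"
    by (simp add: pair_dist_eq_zero_iff pair_act_def pair_scale_def pair_add_def nf_plus nf_add_act nf_ac)
qed

text \<open>The intermediate scalars come from expanding (p - q)(p' - q') and collecting the terms
  of each sign.\<close>

lemma pair_scale_scale: "pair_dist (pair_scale (a * b) z) (pair_scale a (pair_scale b z)) = 0"
proof (rule pair_dist_zero_trans)
  let ?p = "max a 0" and ?q = "max (- a) 0" and ?p' = "max b 0" and ?q' = "max (- b) 0"
  have "?p - ?q = a" "?p' - ?q' = b" "max (a * b) 0 - max (- (a * b)) 0 = a * b" by auto
  then have "max (a * b) 0 - max (- (a * b)) 0 = (?p - ?q) * (?p' - ?q')" by simp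
  also have "\<dots> = (?p * ?p' + ?q * ?q') - (?p * ?q' + ?q * ?p')" by (simp only: algebra_simps)
  finally show "pair_dist (pair_scale (a * b) z) (pair_act (?p * ?p' + ?q * ?q') (?p * ?q' + ?q * ?p') z) = 0"
    unfolding pair_scale_def by (intro pair_act_cong add_nonneg_nonneg mult_nonneg_nonneg) simp_all
  have "pair_dist (pair_act (p * p' + q * q') (p * q' + q * p') z) (pair_act p q (pair_act p' q' z)) = 0"
    if "0 \<le> p" "0 \<le> q" "0 \<le> p'" "0 \<le> q'" for p q p' q'
    using that by (simp add: pair_dist_eq_zero_iff pair_act_def nf_plus nf_act_add nf_add_act nf_act_act nf_ac)
  then show "pair_dist (pair_act (?p * ?p' + ?q * ?q') (?p * ?q' + ?q * ?p') z) (pair_scale a (pair_scale b z)) = 0"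
    by (simp add: pair_scale_def)
qed

lemma pair_scale_dist: "pair_dist (pair_scale a z) (pair_scale a w) = \<bar>a\<bar> * pair_dist z w"
proof (cases "0 \<le> a")
  case True
  then have "pair_dist (pair_scale a z) (pair_scale a w)
    = \<delta> (act a (fst z + snd w)) (act a (fst w + snd z))"
    unfolding pair_dist_def pair_scale_def pair_act_def
    by (intro dist_cong) (simp_all add: nf_plus nf_act_add nf_ac max_def)
  then show ?thesis using True by (simp add: act_dist pair_dist_def)
next
  case False
  \<comment> \<open>A negative scalar swaps the components, so the arguments of \<delta> change
    places.\<close>
  then have "pair_dist (pair_scale a z) (pair_scale a w)
    = \<delta> (act (- a) (fst w + snd z)) (act (- a) (fst z + snd w))"
    unfolding pair_dist_def pair_scale_def pair_act_def
    by (intro dist_cong) (simp_all add: nf_plus nf_act_add nf_ac max_def)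
  then show ?thesis using False by (simp add: act_dist pair_dist_def sym)
qed

lemma pseudo_normed_space_pairs: "pseudo_normed_space UNIV pair_dist (0, 0) pair_add pair_scale"
proof
  show "pair_dist x x = 0" for x by (simp add: pair_dist_def refl)
  show "pair_dist x y = pair_dist y x" for x y by (simp add: pair_dist_def sym)
  show "pair_dist (pair_add x z) (pair_add y z) \<le> pair_dist x y" for x y z
  proof -
    have "pair_dist (pair_add x z) (pair_add y z) =
      \<delta> (fst z + snd z + (fst x + snd y)) (fst z + snd z + (fst y + snd x))"
      unfolding pair_dist_def pair_add_def by (rule dist_cong) (simp_all add: nf_plus nf_ac)
    then show ?thesis by (simp add: pair_dist_def)
  qed
  show "pair_dist (pair_scale a (pair_add x y)) (pair_add (pair_scale a x) (pair_scale a y)) = 0" for a x y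
    by (simp add: pair_dist_eq_zero_iff pair_add_def pair_scale_def pair_act_def nf_plus nf_act_add nf_ac)
qed (simp_all add: pair_dist_triangle pair_scale_dist pair_scale_add_left pair_scale_scale,
    simp_all add: pair_dist_eq_zero_iff pair_add_def pair_scale_def pair_act_def nf_plus nf_ac)

end

section \<open>The isometric embedding and its closed image\<close>

theorem proposition3p1:
  fixes \<delta> :: "'a::monoid_add \<Rightarrow> 'a \<Rightarrow> real"
    and act :: "real \<Rightarrow> 'a \<Rightarrow> 'a"
  assumes "nonneg_real_semimodule \<delta> act"
    and "pm_complete \<delta>"
  shows "\<exists>(B :: (real, 'a difference_limit) module) N (f :: 'a \<Rightarrow> 'a difference_limit).
    real_banach_module B N \<and>
    (\<forall>x. f x \<in> carrier B) \<and>
    (\<forall>x y. f (x + y) = f x \<oplus>\<^bsub>B\<^esub> f y) \<and>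
    (\<forall>a\<ge>0. \<forall>x. f (act a x) = a \<odot>\<^bsub>B\<^esub> f x) \<and>
    (\<forall>x y. N (f x \<ominus>\<^bsub>B\<^esub> f y) = \<delta> x y) \<and>
    convex_cone_in B (range f) \<and>
    closedin (norm_topology B N) (range f)"
proof -
  interpret nonneg_real_semimodule \<delta> act by fact
  interpret P: pseudo_normed_space UNIV pair_dist "(0, 0)" pair_add pair_scale
    by (rule pseudo_normed_space_pairs)
  interpret C: pseudo_normed_space P.Cauchy_seqs P.lim_dist "\<lambda>_. (0, 0)"
    "\<lambda>s t n. pair_add (s n) (t n)" "\<lambda>a s n. pair_scale a (s n)"
    by (rule P.pseudo_normed_space_completion)
  let ?B = C.quotient and ?N = C.quotient_norm
  \<comment> \<open>The element x is viewed as the formal difference x - 0, and this as a constant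
    Cauchy sequence.\<close>
  define c where "c x = (\<lambda>_::nat. (x, 0 :: 'a))" for x :: 'a
  define f where "f x = C.coset (c x)" for x
  have c: "c x \<in> P.Cauchy_seqs" for x by (simp add: c_def P.const_Cauchy_seqs)
  have dist_c: "P.lim_dist (c x) (c y) = \<delta> x y" for x y
    by (rule P.lim_dist_eqI) (simp add: c_def pair_dist_def)
  have carrier: "f x \<in> carrier ?B" for x using c by (simp add: f_def C.carrier_quotient)
  \<comment> \<open>The representing sequences agree exactly, since 0 + 0 = 0.\<close>
  have add: "f (x + y) = f x \<oplus>\<^bsub>?B\<^esub> f y" for x y
    using c by (simp add: f_def C.add_quotient) (simp add: c_def pair_add_def)
  have act: "f (act a x) = a \<odot>\<^bsub>?B\<^esub> f x" if "0 \<le> a" for a x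
  proof -
    \<comment> \<open>Here the negative part of a is 0, and the terms \<open>act 0 x\<close>,
      \<open>act 0 0\<close> and \<open>act a 0\<close> all normalize to
      \<open>nf 0\<close>.\<close>
    have "P.lim_dist (c (act a x)) (\<lambda>n. pair_scale a (c x n)) = 0"
      using that by (intro P.lim_dist_eqI)
        (simp add: c_def pair_dist_eq_zero_iff pair_scale_def pair_act_def nf_plus max_def)
    then show ?thesis
      using c P.Cauchy_seqs_scale[OF c] by (simp add: f_def C.smult_quotient C.coset_eq_iff)
  qed
  have dist: "?N (f x \<ominus>\<^bsub>?B\<^esub> f y) = \<delta> x y" for x y
    using c by (simp add: f_def C.norm_minus_quotient dist_c)
  have cone: "convex_cone_in ?B (range f)"
    unfolding convex_cone_in_def
    \<comment> \<open>Read from right to left, \<open>add\<close> and \<open>act\<close> turn convex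
      combinations and multiples into values of \<open>f\<close>.\<close>
    using carrier by (auto simp flip: add act)
  interpret Q: Metric_space "carrier ?B" "norm_dist ?B ?N"
    by (rule C.Metric_space_quotient)
  have "closedin Q.mtopology (range f)"
    unfolding Q.metric_closedin_iff_sequentially_closed
  proof (intro conjI allI impI)
    show "range f \<subseteq> carrier ?B" using carrier by blast
    fix \<sigma> l assume \<sigma>: "range \<sigma> \<subseteq> range f \<and> limitin Q.mtopology \<sigma> l sequentially"
    then have "\<forall>n. \<exists>x. \<sigma> n = f x" by blast
    then obtain s where "\<And>n. \<sigma> n = f (s n)" by metis
    then have s: "\<sigma> = (\<lambda>n. f (s n))" by blast
    \<comment> \<open>Being Cauchy is pulled back along the isometry, completeness of \<delta>
      yields x, and uniqueness of limits in the quotient identifies \<open>l\<close> with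
      \<open>f x\<close>.\<close>
    have "Q.MCauchy \<sigma>"
      using \<sigma> carrier by (intro Q.convergent_imp_MCauchy[of _ l]) (auto simp: s)
    then have "pm_Cauchy P.lim_dist (\<lambda>n. c (s n))"
      using c C.MCauchy_quotient[of "\<lambda>n. c (s n)"] by (simp add: s f_def)
    then have "pm_Cauchy \<delta> s" by (simp add: pm_Cauchy_def dist_c)
    then obtain x where "(\<lambda>n. \<delta> (s n) x) \<longlonglongrightarrow> 0"
      using assms(2) unfolding pm_complete_def by blast
    then have "limitin Q.mtopology \<sigma> (f x) sequentially"
      using c C.limitin_quotient[of "\<lambda>n. c (s n)" "c x"]
      by (simp add: dist_c s f_def norm_topology_def)
    then have "l = f x" using \<sigma> Q.limitin_metric_unique trivial_limit_sequentially by blast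
    then show "l \<in> range f" by blast
  qed
  then have "closedin (norm_topology ?B ?N) (range f)" by (simp add: norm_topology_def)
  moreover have "real_banach_module ?B ?N"
    using P.complete_completion by (rule C.banach_quotient)
  ultimately show ?thesis using carrier add act dist cone by blast
qed

end
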